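(* Let $\alpha,\beta,b,c,z\in\mathbb{C}$ with $\mathrm{Re}(\alpha)>-1$ and $\mathrm{Re}(c)>\mathrm{Re}(b)>0$, and let $p\geq 0$. Then the $\Psi$-confluent hypergeometric function has the integral representations $${}^{\Psi}\Phi_{p}^{(\alpha,\beta)}(b;c;z)=\frac{1}{B(b,c-b)}\int_{0}^{1}t^{b-1}(1-t)^{c-b-1}\exp(zt)\;{}_{0}\Psi_{1}\left( \alpha,\beta;-\frac{p}{t(1-t)}\right)dt,$$ $${}^{\Psi}\Phi_{p}^{(\alpha,\beta)}(b;c;z)=\frac{1}{B(b,c-b)}\int_{0}^{1}u^{c-b-1}(1-u)^{b-1}\exp(z(1-u))\;{}_{0}\Psi_{1}\left( \alpha,\beta;-\frac{p}{u(1-u)}\right) du.$$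
   Context: For $\alpha,\beta\in\mathbb{C}$ with $\mathrm{Re}(\alpha)>-1$, the Wright function is ${}_{0}\Psi_{1}(\alpha,\beta;z)=\sum_{n=0}^{\infty}\frac{1}{\Gamma(\alpha n+\beta)}\frac{z^n}{n!}$ (with $1/\Gamma$ equal to $0$ at the poles of $\Gamma$). The $\Psi$-beta function is, for $\mathrm{Re}(x)>0$, $\mathrm{Re}(y)>0$ and $\mathrm{Re}(p)>0$ (or $p=0$, by the same formula), $${}^{\Psi}B_{p}^{(\alpha,\beta)}(x,y)=\int_{0}^{1}t^{x-1}(1-t)^{y-1}\,{}_{0}\Psi_{1}\left(\alpha,\beta;-\frac{p}{t(1-t)}\right)dt.$$ The $\Psi$-confluent hypergeometric function is $${}^{\Psi}\Phi_{p}^{(\alpha,\beta)}(b;c;z)=\sum_{n=0}^{\infty}\frac{{}^{\Psi}B_{p}^{(\alpha,\beta)}(b+n,c-b)}{B(b,c-b)}\frac{z^{n}}{n!},$$ where $B$ is the classical beta function.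
   Formalization: For p > 0 the formal theorem also assumes that the integral defining the Ψ-beta function at (b, c−b) converges (possibly conditionally); this can fail under the stated hypotheses, e.g. α=1, β=−5/2, b=1/2, c=10, p=1, where the series' first coefficient is undefined. *)

theory Defs
  imports "HOL-Analysis.Analysis"
begin

text \<open>The library function \<open>rGamma\<close> is the entire function \<open>1 / Gamma\<close>, with value 0 at
  the poles of \<open>Gamma\<close>.\<close>

definition wright_psi :: "complex \<Rightarrow> complex \<Rightarrow> complex \<Rightarrow> complex" where
  "wright_psi \<alpha> \<beta> z = (\<Sum>n. rGamma (\<alpha> * of_nat n + \<beta>) * z ^ n / fact n)"

definition psi_beta_integrand ::
    "complex \<Rightarrow> complex \<Rightarrow> complex \<Rightarrow> complex \<Rightarrow> complex \<Rightarrow> real \<Rightarrow> complex" where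
  "psi_beta_integrand \<alpha> \<beta> p x y t =
     of_real t powr (x - 1) * of_real (1 - t) powr (y - 1)
       * wright_psi \<alpha> \<beta> (- p / of_real (t * (1 - t)))"

text \<open>Integrals over the unit interval are Henstock--Kurzweil integrals, which cover absolutely
  convergent as well as conditionally convergent improper integrals. The values that the
  integrand takes at the end points, where Isabelle reads division by 0 as 0, are irrelevant.\<close>

definition psi_beta ::
    "complex \<Rightarrow> complex \<Rightarrow> complex \<Rightarrow> complex \<Rightarrow> complex \<Rightarrow> complex" where
  "psi_beta \<alpha> \<beta> p x y = integral {0..1} (psi_beta_integrand \<alpha> \<beta> p x y)"

definition psi_confluent_term ::
    "complex \<Rightarrow> complex \<Rightarrow> complex \<Rightarrow> complex \<Rightarrow> complex \<Rightarrow> complex \<Rightarrow> nat \<Rightarrow> complex" where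
  "psi_confluent_term \<alpha> \<beta> p b c z n =
     psi_beta \<alpha> \<beta> p (b + of_nat n) (c - b) / Beta b (c - b) * z ^ n / fact n"

definition psi_confluent ::
    "complex \<Rightarrow> complex \<Rightarrow> complex \<Rightarrow> complex \<Rightarrow> complex \<Rightarrow> complex \<Rightarrow> complex" where
  "psi_confluent \<alpha> \<beta> p b c z = (\<Sum>n. psi_confluent_term \<alpha> \<beta> p b c z n)"

end

theory Submission
  imports Defs
begin

text \<open>Expanding \<open>exp (z * t)\<close> in powers of \<open>t\<close> turns the integral into the series, because a factor
  \<open>t ^ n\<close> raises the first argument of the \<open>\<Psi>\<close>-beta integrand from \<open>b\<close> to \<open>b + n\<close>. What has to
  be justified is the exchange of sum and integral. The integrand is only known to be
  Henstock--Kurzweil integrable and its integral may converge conditionally, so no integrable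
  majorant need exist.

  The exchange rests instead on the smoothness of the other factor. By the second mean value
  theorem, multiplication by a monotone \<open>g\<close> preserves integrability, and the absolute value of
  the integral of the product is at most a constant times \<open>\<bar>g 0\<bar> + \<bar>g 1\<bar>\<close>. A Lipschitz function
  is a difference of two monotone ones, whence \<open>integral_lipschitz_mult_bound\<close>: for fixed \<open>f\<close>,
  the integral of \<open>g * f\<close> is bounded in norm by a multiple of \<open>norm (g 0) + K\<close>, where \<open>K\<close> is a
  Lipschitz constant of \<open>g\<close>. The tail of a power series \<open>\<Sum>n. a n * t ^ n\<close> from index \<open>N\<close> on has
  on the unit interval the Lipschitz constant \<open>\<Sum>n. (n + N) * norm (a (n + N))\<close>, so that
  \<open>integral_power_series_sums\<close> integrates the series termwise against every integrable \<open>f\<close> as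
  soon as \<open>\<Sum>n. n * norm (a n)\<close> converges. For the exponential series it does.

  When \<open>p = 0\<close> the Wright function contributes a constant factor, and the integrand is
  absolutely integrable by comparison with the real beta integral. The second
  representation is the first one under the reflection \<open>t = 1 - u\<close>.\<close>

section \<open>Products with monotone and with Lipschitz functions\<close>

text \<open>The second mean value theorem writes the integral as \<open>g 0\<close> and \<open>g 1\<close> times integrals of \<open>f\<close> over
  two complementary subintervals. These depend continuously on the point of division, so a single
  \<open>M\<close> bounds them all.\<close>

lemma integral_mono_mult_bound:
  fixes f :: "real \<Rightarrow> real"
  assumes f: "f integrable_on {0..1}"
  obtains M where "M \<ge> 0"
    and "\<And>g. mono_on {0..1} g \<Longrightarrow> (\<lambda>t. g t * f t) integrable_on {0..1}"
    and "\<And>g. mono_on {0..1} g \<Longrightarrow>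
           \<bar>integral {0..1} (\<lambda>t. g t * f t)\<bar> \<le> M * (\<bar>g 0\<bar> + \<bar>g 1\<bar>)"
proof -
  have "bounded ((\<lambda>x. integral {0..x} f) ` {0..1})" "bounded ((\<lambda>x. integral {x..1} f) ` {0..1})"
    by (intro compact_imp_bounded compact_continuous_image
          indefinite_integral_continuous_1 indefinite_integral_continuous_1' f compact_Icc)+
  then obtain M1 M2 where M1: "\<And>x. x \<in> {0..1} \<Longrightarrow> \<bar>integral {0..x} f\<bar> \<le> M1"
    and M2: "\<And>x. x \<in> {0..1} \<Longrightarrow> \<bar>integral {x..1} f\<bar> \<le> M2"
    unfolding bounded_iff by (auto simp del: atLeastAtMost_iff)
  define M where "M = max M1 M2"
  have le: "\<bar>integral {0..x} f\<bar> \<le> M" "\<bar>integral {x..1} f\<bar> \<le> M" if "x \<in> {0..1}" for x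
    using M1[OF that] M2[OF that] by (auto simp: M_def)
  have "M \<ge> 0"
    using le(1)[of 0] by simp
  moreover have "(\<lambda>t. g t * f t) integrable_on {0..1} \<and>
      \<bar>integral {0..1} (\<lambda>t. g t * f t)\<bar> \<le> M * (\<bar>g 0\<bar> + \<bar>g 1\<bar>)" if g: "mono_on {0..1} g" for g
  proof -
    obtain c where c: "c \<in> {0..1}"
      and I: "((\<lambda>t. g t * f t) has_integral (g 0 * integral {0..c} f + g 1 * integral {c..1} f)) {0..1}"
      using second_mean_value_theorem_full[OF f, of g] g by (auto simp: mono_on_def)
    have "\<bar>g 0 * integral {0..c} f + g 1 * integral {c..1} f\<bar>
        \<le> \<bar>g 0\<bar> * \<bar>integral {0..c} f\<bar> + \<bar>g 1\<bar> * \<bar>integral {c..1} f\<bar>"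
      by (metis abs_mult abs_triangle_ineq)
    also have "\<dots> \<le> \<bar>g 0\<bar> * M + \<bar>g 1\<bar> * M"
      by (intro add_mono mult_left_mono le c) auto
    finally show ?thesis
      using I by (simp add: has_integral_iff algebra_simps)
  qed
  ultimately show thesis
    using that by blast
qed

text \<open>If \<open>g\<close> has Lipschitz constant \<open>K\<close>, then \<open>g t + K * t\<close> is monotone, and so is \<open>K * t\<close>.\<close>

lemma integral_lipschitz_mult_bound_real:
  fixes f :: "real \<Rightarrow> real"
  assumes f: "f integrable_on {0..1}"
  obtains M where "M \<ge> 0"
    and "\<And>g K. K-lipschitz_on {0..1} g \<Longrightarrow> (\<lambda>t. g t * f t) integrable_on {0..1}"
    and "\<And>g K. K-lipschitz_on {0..1} g \<Longrightarrow>
           \<bar>integral {0..1} (\<lambda>t. g t * f t)\<bar> \<le> M * (\<bar>g 0\<bar> + K)"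
proof -
  obtain M where M: "M \<ge> 0"
    and int: "\<And>g. mono_on {0..1} g \<Longrightarrow> (\<lambda>t. g t * f t) integrable_on {0..1}"
    and bound: "\<And>g. mono_on {0..1} g \<Longrightarrow>
        \<bar>integral {0..1} (\<lambda>t. g t * f t)\<bar> \<le> M * (\<bar>g 0\<bar> + \<bar>g 1\<bar>)"
    by (rule integral_mono_mult_bound[OF f]) (rule that)
  have "(\<lambda>t. g t * f t) integrable_on {0..1} \<and>
      \<bar>integral {0..1} (\<lambda>t. g t * f t)\<bar> \<le> 3 * M * (\<bar>g 0\<bar> + K)"
    if g: "K-lipschitz_on {0..1} g" for g K
  proof -
    define h where "h = (\<lambda>t. g t + K * t)"
    have K: "K \<ge> 0"
      using g by (rule lipschitz_on_nonneg)
    have gdiff: "\<bar>g x - g y\<bar> \<le> K * \<bar>x - y\<bar>" if "x \<in> {0..1}" "y \<in> {0..1}" for x y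
      using lipschitz_onD[OF g that] by (simp add: dist_real_def)
    have h: "mono_on {0..1} h"
    proof (rule mono_onI)
      fix x y :: real
      assume "x \<in> {0..1}" "y \<in> {0..1}" "x \<le> y"
      then show "h x \<le> h y"
        using gdiff[of x y] by (simp add: h_def algebra_simps)
    qed
    have l: "mono_on {0..1} (\<lambda>t. K * t)"
      using K by (auto intro!: mono_onI mult_left_mono)
    have eq: "(\<lambda>t. g t * f t) = (\<lambda>t. h t * f t - K * t * f t)"
      by (auto simp: h_def algebra_simps)
    have "\<bar>integral {0..1} (\<lambda>t. g t * f t)\<bar> \<le> M * (\<bar>h 0\<bar> + \<bar>h 1\<bar>) + M * K"
      unfolding eq integral_diff[OF int[OF h] int[OF l]]
      using bound[OF h] bound[OF l] K by simp
    also have "\<bar>h 1\<bar> \<le> \<bar>g 0\<bar> + 2 * K"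
      using gdiff[of 1 0] by (simp add: h_def)
    then have "M * (\<bar>h 0\<bar> + \<bar>h 1\<bar>) + M * K \<le> M * (\<bar>g 0\<bar> + (\<bar>g 0\<bar> + 2 * K)) + M * K"
      using M by (intro add_right_mono mult_left_mono) (auto simp: h_def)
    also have "\<dots> \<le> 3 * M * (\<bar>g 0\<bar> + K)"
      using M by (simp add: algebra_simps)
    finally show ?thesis
      unfolding eq using integrable_diff[OF int[OF h] int[OF l]] by simp
  qed
  then show thesis
    using that[of "3 * M"] M by fastforce
qed

lemma lipschitz_on_Re: "K-lipschitz_on S g \<Longrightarrow> K-lipschitz_on S (\<lambda>t. Re (g t))"
  unfolding lipschitz_on_def dist_complex_def dist_real_def
  by (metis abs_Re_le_cmod minus_complex.simps(1) order_trans)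

lemma lipschitz_on_Im: "K-lipschitz_on S g \<Longrightarrow> K-lipschitz_on S (\<lambda>t. Im (g t))"
  unfolding lipschitz_on_def dist_complex_def dist_real_def
  by (metis abs_Im_le_cmod minus_complex.simps(2) order_trans)

text \<open>The complex case follows by splitting both factors into real and imaginary parts. The
  constant \<open>C\<close> depends on \<open>f\<close> alone, which is what makes the bound tend to 0 along the tails of a
  power series.\<close>

lemma integral_lipschitz_mult_bound:
  fixes f :: "real \<Rightarrow> complex"
  assumes f: "f integrable_on {0..1}"
  obtains C where
    "\<And>g K. K-lipschitz_on {0..1} g \<Longrightarrow> (\<lambda>t. g t * f t) integrable_on {0..1}"
    and "\<And>g K. K-lipschitz_on {0..1} g \<Longrightarrow>
           norm (integral {0..1} (\<lambda>t. g t * f t)) \<le> C * (norm (g 0) + K)"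
proof -
  have fR: "(\<lambda>t. Re (f t)) integrable_on {0..1}" and fI: "(\<lambda>t. Im (f t)) integrable_on {0..1}"
    using integrable_linear[OF f bounded_linear_Re] integrable_linear[OF f bounded_linear_Im]
    by (simp_all add: o_def)
  obtain A where A: "A \<ge> 0"
    and Ai: "\<And>g K. K-lipschitz_on {0..1} g \<Longrightarrow> (\<lambda>t. g t * Re (f t)) integrable_on {0..1}"
    and Ab: "\<And>g K. K-lipschitz_on {0..1} g \<Longrightarrow>
        \<bar>integral {0..1} (\<lambda>t. g t * Re (f t))\<bar> \<le> A * (\<bar>g 0\<bar> + K)"
    by (rule integral_lipschitz_mult_bound_real[OF fR]) (rule that)
  obtain B where B: "B \<ge> 0"
    and Bi: "\<And>g K. K-lipschitz_on {0..1} g \<Longrightarrow> (\<lambda>t. g t * Im (f t)) integrable_on {0..1}"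
    and Bb: "\<And>g K. K-lipschitz_on {0..1} g \<Longrightarrow>
        \<bar>integral {0..1} (\<lambda>t. g t * Im (f t))\<bar> \<le> B * (\<bar>g 0\<bar> + K)"
    by (rule integral_lipschitz_mult_bound_real[OF fI]) (rule that)
  have "(\<lambda>t. g t * f t) integrable_on {0..1} \<and>
      norm (integral {0..1} (\<lambda>t. g t * f t)) \<le> 2 * (A + B) * (norm (g 0) + K)"
    if g: "K-lipschitz_on {0..1} g" for g K
  proof -
    note gR = lipschitz_on_Re[OF g] and gI = lipschitz_on_Im[OF g]
    let ?J = "\<lambda>u v. integral {0..1} (\<lambda>t. u (g t) * v (f t))"
    define P where "P = ?J Re Re - ?J Im Im"
    define Q where "Q = ?J Re Im + ?J Im Re"
    have hP: "((\<lambda>t. Re (g t) * Re (f t) - Im (g t) * Im (f t)) has_integral P) {0..1}"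
      unfolding P_def
      by (intro has_integral_diff integrable_integral Ai[OF gR] Bi[OF gI])
    have hQ: "((\<lambda>t. Re (g t) * Im (f t) + Im (g t) * Re (f t)) has_integral Q) {0..1}"
      unfolding Q_def
      by (intro has_integral_add integrable_integral Bi[OF gR] Ai[OF gI])
    have "((\<lambda>t. of_real (Re (g t) * Re (f t) - Im (g t) * Im (f t))
        + \<i> * of_real (Re (g t) * Im (f t) + Im (g t) * Re (f t)))
        has_integral (of_real P + \<i> * of_real Q)) {0..1}"
      by (intro has_integral_add has_integral_mult_right hP hQ
          has_integral_linear[OF _ bounded_linear_of_real, unfolded o_def])
    moreover have "of_real (Re (g t) * Re (f t) - Im (g t) * Im (f t))
        + \<i> * of_real (Re (g t) * Im (f t) + Im (g t) * Re (f t)) = g t * f t" for t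
      by (rule complex_eqI) simp_all
    ultimately have h: "((\<lambda>t. g t * f t) has_integral Complex P Q) {0..1}"
      by (simp only: Complex_eq)
    define U where "U = A * (norm (g 0) + K)"
    define V where "V = B * (norm (g 0) + K)"
    have U: "A * (\<bar>Re (g 0)\<bar> + K) \<le> U" "A * (\<bar>Im (g 0)\<bar> + K) \<le> U"
      using A abs_Re_le_cmod[of "g 0"] abs_Im_le_cmod[of "g 0"]
      by (auto simp: U_def intro!: mult_left_mono)
    have V: "B * (\<bar>Re (g 0)\<bar> + K) \<le> V" "B * (\<bar>Im (g 0)\<bar> + K) \<le> V"
      using B abs_Re_le_cmod[of "g 0"] abs_Im_le_cmod[of "g 0"]
      by (auto simp: V_def intro!: mult_left_mono)
    have PQ: "\<bar>P\<bar> \<le> U + V" "\<bar>Q\<bar> \<le> U + V"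
      unfolding P_def Q_def
      using order_trans[OF Ab[OF gR] U(1)] order_trans[OF Bb[OF gI] V(2)]
        order_trans[OF Bb[OF gR] V(1)] order_trans[OF Ab[OF gI] U(2)]
      by (simp_all only: abs_le_iff) linarith+
    have "norm (Complex P Q) \<le> \<bar>P\<bar> + \<bar>Q\<bar>"
      using cmod_le[of "Complex P Q"] by simp
    also have "\<dots> \<le> 2 * (U + V)"
      unfolding mult_2 using PQ by (rule add_mono)
    also have "\<dots> = 2 * (A + B) * (norm (g 0) + K)"
      by (simp only: U_def V_def distrib_right mult.assoc)
    finally show ?thesis
      by (simp only: has_integral_integrable[OF h] integral_unique[OF h] simp_thms)
  qed
  then show thesis
    by (intro that[of "2 * (A + B)"]) simp_all
qed

section \<open>Termwise integration of power series\<close>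

lemma summable_power_series_unit_interval:
  fixes a :: "nat \<Rightarrow> complex" and x :: real
  assumes a: "summable (\<lambda>n. real n * norm (a n))" and x: "x \<in> {0..1}"
  shows "summable (\<lambda>n. a n * of_real x ^ n)"
proof (rule summable_comparison_test'[OF a])
  show "norm (a n * of_real x ^ n) \<le> real n * norm (a n)" if "n \<ge> 1" for n
  proof -
    have "norm (a n) * \<bar>x\<bar> ^ n \<le> norm (a n) * 1"
      using x by (intro mult_left_mono power_le_one) auto
    also have "\<dots> \<le> real n * norm (a n)"
      using that mult_right_mono[of 1 "real n" "norm (a n)"] by simp
    finally show ?thesis
      by (simp add: norm_mult norm_power)
  qed
qed

lemma lipschitz_on_power_series:
  fixes a :: "nat \<Rightarrow> complex"
  assumes a: "summable (\<lambda>n. real n * norm (a n))"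
  shows "(\<Sum>n. real n * norm (a n))-lipschitz_on {0..1} (\<lambda>t::real. \<Sum>n. a n * of_real t ^ n)"
proof (rule lipschitz_onI)
  fix s t :: real
  assume s: "s \<in> {0..1}" and t: "t \<in> {0..1}"
  note sm = summable_power_series_unit_interval[OF a]
  have term_le: "norm (a n * of_real s ^ n - a n * of_real t ^ n) \<le> real n * norm (a n) * dist s t" for n
  proof -
    have "norm (a n * of_real s ^ n - a n * of_real t ^ n)
        = norm (a n) * norm (of_real s ^ n - of_real t ^ n :: complex)"
      by (simp add: norm_mult flip: right_diff_distrib)
    also have "\<dots> \<le> norm (a n) * (real n * norm (of_real s - of_real t :: complex))"
      using s t by (intro mult_left_mono norm_power_diff) auto
    finally show ?thesis
      by (simp add: dist_real_def mult_ac flip: of_real_diff)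
  qed
  have "dist (\<Sum>n. a n * of_real s ^ n) (\<Sum>n. a n * of_real t ^ n)
      = norm (\<Sum>n. a n * of_real s ^ n - a n * of_real t ^ n)"
    unfolding dist_norm by (simp only: suminf_diff[OF sm[OF s] sm[OF t]])
  also have "\<dots> \<le> (\<Sum>n. real n * norm (a n) * dist s t)"
    by (intro norm_suminf_le term_le summable_mult2 a)
  also have "\<dots> = (\<Sum>n. real n * norm (a n)) * dist s t"
    by (rule suminf_mult2[symmetric]) (rule a)
  finally show "dist (\<Sum>n. a n * of_real s ^ n) (\<Sum>n. a n * of_real t ^ n)
      \<le> (\<Sum>n. real n * norm (a n)) * dist s t" .
qed (simp add: suminf_nonneg a)

text \<open>The error of the \<open>N\<close>-th partial sum is the integral of \<open>f\<close> against the tail of the series,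
  which is again a power series, with the first \<open>N\<close> coefficients replaced by 0. Its value at 0
  is 0 for \<open>N > 0\<close>, and its Lipschitz constant tends to 0.\<close>

lemma integral_power_series_sums:
  fixes f :: "real \<Rightarrow> complex" and a :: "nat \<Rightarrow> complex"
  assumes f: "f integrable_on {0..1}"
    and a: "summable (\<lambda>n. real n * norm (a n))"
  shows "(\<lambda>t. (\<Sum>n. a n * of_real t ^ n) * f t) integrable_on {0..1}"
    and "(\<lambda>n. a n * integral {0..1} (\<lambda>t. of_real t ^ n * f t)) sums
           integral {0..1} (\<lambda>t. (\<Sum>n. a n * of_real t ^ n) * f t)"
proof -
  obtain C where int: "\<And>g K. K-lipschitz_on {0..1} g \<Longrightarrow> (\<lambda>t. g t * f t) integrable_on {0..1}"
    and bound: "\<And>g K. K-lipschitz_on {0..1} g \<Longrightarrow>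
        norm (integral {0..1} (\<lambda>t. g t * f t)) \<le> C * (norm (g 0) + K)"
    by (rule integral_lipschitz_mult_bound[OF f]) (rule that)
  define G where "G = (\<lambda>t::real. \<Sum>n. a n * of_real t ^ n)"
  define c where "c = (\<lambda>N n. if n < N then 0 else a n)"
  define T where "T = (\<lambda>N (t::real). \<Sum>n. c N n * of_real t ^ n)"
  define L where "L = (\<lambda>N. \<Sum>n. real (n + N) * norm (a (n + N)))"
  have c_sums: "(\<lambda>n. real n * norm (c N n)) sums L N" for N
  proof (rule iffD1[OF sums_iff_shift'])
    show "(\<lambda>n. real (n + N) * norm (c N (n + N))) sums (L N - (\<Sum>n<N. real n * norm (c N n)))"
      using summable_sums[OF summable_ignore_initial_segment[OF a]] by (simp add: c_def L_def)
  qed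
  have lip_T: "(L N)-lipschitz_on {0..1} (T N)" for N
    using lipschitz_on_power_series[OF sums_summable[OF c_sums]] sums_unique[OF c_sums]
    by (simp add: T_def)
  have G_eq: "G = T 0"
    by (simp add: G_def T_def c_def)
  have G_int: "(\<lambda>t. G t * f t) integrable_on {0..1}"
    unfolding G_eq by (rule int) (rule lip_T)
  then show "(\<lambda>t. (\<Sum>n. a n * of_real t ^ n) * f t) integrable_on {0..1}"
    by (simp only: G_def)
  have pow_int: "(\<lambda>t. of_real t ^ n * f t) integrable_on {0..1}" for n
  proof (rule int)
    show "(real n)-lipschitz_on {0..1} (\<lambda>t. of_real t ^ n :: complex)"
    proof (rule lipschitz_onI)
      show "dist (of_real s ^ n :: complex) (of_real t ^ n) \<le> real n * dist s t"
        if "s \<in> {0..1}" "t \<in> {0..1}" for s t :: real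
        using norm_power_diff[of "of_real s :: complex" "of_real t" n] that
        by (simp add: dist_norm flip: of_real_diff)
    qed simp
  qed
  have tail: "integral {0..1} (\<lambda>t. T N t * f t) = integral {0..1} (\<lambda>t. G t * f t)
      - (\<Sum>n<N. a n * integral {0..1} (\<lambda>t. of_real t ^ n * f t))" for N
  proof -
    have T_eq: "T N t * f t = G t * f t - (\<Sum>n<N. a n * (of_real t ^ n * f t))"
      if t: "t \<in> {0..1}" for t
    proof -
      have "(\<lambda>n. a n * of_real t ^ n - (if n < N then a n * of_real t ^ n else 0))
          sums (G t - (\<Sum>n<N. a n * of_real t ^ n))"
        unfolding G_def
        using sums_diff[OF summable_sums[OF summable_power_series_unit_interval[OF a t]]
            sums_If_finite_set[of "{..<N}" "\<lambda>n. a n * of_real t ^ n"]]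
        by simp
      also have "(\<lambda>n. a n * of_real t ^ n - (if n < N then a n * of_real t ^ n else 0))
          = (\<lambda>n. c N n * of_real t ^ n)"
        by (auto simp: c_def)
      finally have "T N t = G t - (\<Sum>n<N. a n * of_real t ^ n)"
        unfolding T_def by (rule sums_unique[symmetric])
      then show ?thesis
        by (simp add: left_diff_distrib sum_distrib_right mult.assoc)
    qed
    have "((\<lambda>t. G t * f t - (\<Sum>n<N. a n * (of_real t ^ n * f t))) has_integral
        (integral {0..1} (\<lambda>t. G t * f t)
          - (\<Sum>n<N. a n * integral {0..1} (\<lambda>t. of_real t ^ n * f t)))) {0..1}"
      by (intro has_integral_diff has_integral_sum has_integral_mult_right integrable_integral
          pow_int G_int finite_lessThan)
    then have "((\<lambda>t. T N t * f t) has_integral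
        (integral {0..1} (\<lambda>t. G t * f t)
          - (\<Sum>n<N. a n * integral {0..1} (\<lambda>t. of_real t ^ n * f t)))) {0..1}"
      by (rule has_integral_eq[rotated]) (simp add: T_eq)
    then show ?thesis
      by (rule integral_unique)
  qed
  have "L \<longlonglongrightarrow> 0"
    unfolding L_def suminf_minus_initial_segment[OF a]
    using tendsto_diff[OF tendsto_const[of "\<Sum>n. real n * norm (a n)"] summable_LIMSEQ[OF a]]
    by simp
  then have lim: "(\<lambda>N. C * L N) \<longlonglongrightarrow> 0"
    by (rule tendsto_mult_right_zero)
  have "(\<lambda>N. integral {0..1} (\<lambda>t. T N t * f t)) \<longlonglongrightarrow> 0"
  proof (rule Lim_null_comparison[OF _ lim])
    show "\<forall>\<^sub>F N in sequentially. norm (integral {0..1} (\<lambda>t. T N t * f t)) \<le> C * L N"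
      using eventually_gt_at_top[of 0]
    proof eventually_elim
      case (elim N)
      then have "T N 0 = 0"
        by (simp add: T_def c_def powser_zero)
      then show ?case
        using bound[OF lip_T[of N]] by simp
    qed
  qed
  then show "(\<lambda>n. a n * integral {0..1} (\<lambda>t. of_real t ^ n * f t)) sums
           integral {0..1} (\<lambda>t. (\<Sum>n. a n * of_real t ^ n) * f t)"
    using tendsto_diff[OF tendsto_const, of _ 0 sequentially "integral {0..1} (\<lambda>t. G t * f t)"]
    by (force simp: sums_def tail G_def)
qed

lemma exp_mult_power_series: "(\<Sum>n. z ^ n / fact n * t ^ n) = exp (z * t :: complex)"
  using sums_unique[OF exp_converges[of "z * t"]]
  by (simp add: power_mult_distrib scaleR_conv_of_real field_simps)

lemma summable_exp_coeff_weighted: "summable (\<lambda>n. real n * norm (z ^ n / fact n :: complex))"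
proof (subst summable_Suc_iff[symmetric])
  have "(\<lambda>n. real (Suc n) * norm (z ^ Suc n / fact (Suc n)))
      = (\<lambda>n. norm z * (norm z ^ n /\<^sub>R fact n))"
    unfolding norm_divide norm_power norm_fact
    by (auto simp: field_simps simp del: of_nat_Suc)
  then show "summable (\<lambda>n. real (Suc n) * norm (z ^ Suc n / fact (Suc n)))"
    using summable_mult[OF summable_exp_generic[of "norm z"]] by (simp only:)
qed

section \<open>The \<Psi>-beta integrand and reflection\<close>

text \<open>Comparison with the real beta integral of the real parts of the exponents, because
  \<open>norm (of_real t powr w) = t powr Re w\<close> for \<open>t > 0\<close>.\<close>

lemma integrable_on_Beta_complex:
  fixes x y :: complex
  assumes "Re x > 0" "Re y > 0"
  shows "(\<lambda>t::real. of_real t powr (x - 1) * of_real (1 - t) powr (y - 1)) integrable_on {0..1}"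
proof -
  let ?h = "\<lambda>t::real. of_real t powr (x - 1) * of_real (1 - t) powr (y - 1) :: complex"
  have "?h integrable_on {0<..<1}"
  proof (rule measurable_bounded_by_integrable_imp_integrable)
    show "?h \<in> borel_measurable (lebesgue_on {0<..<1})"
      by (intro continuous_imp_measurable_on_sets_lebesgue continuous_intros) auto
    show "(\<lambda>t. t powr (Re x - 1) * (1 - t) powr (Re y - 1)) integrable_on {0<..<1}"
      using integrable_Beta'[OF assms] by (simp add: integrable_on_Icc_iff_Ioo)
    show "norm (?h t) \<le> t powr (Re x - 1) * (1 - t) powr (Re y - 1)" if "t \<in> {0<..<1}" for t
      using that by (simp add: norm_mult norm_powr_real_powr del: of_real_diff)
  qed auto
  then show ?thesis
    by (simp add: integrable_on_Icc_iff_Ioo)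
qed

text \<open>At \<open>t = 0\<close> both integrands vanish, because \<open>0 powr w = 0\<close> for every \<open>w\<close>.\<close>

lemma psi_beta_integrand_add_nat:
  assumes "t \<ge> 0"
  shows "psi_beta_integrand \<alpha> \<beta> p (x + of_nat n) y t = of_real t ^ n * psi_beta_integrand \<alpha> \<beta> p x y t"
proof (cases "t = 0")
  case False
  then have "of_real t powr (x + of_nat n - 1) = of_real t ^ n * (of_real t powr (x - 1) :: complex)"
    using powr_add[of "of_real t :: complex" "x - 1" "of_nat n"]
    by (simp add: powr_nat' algebra_simps)
  then show ?thesis
    by (simp add: psi_beta_integrand_def)
qed (simp add: psi_beta_integrand_def)

lemma has_integral_reflect_unit_interval:
  fixes f :: "real \<Rightarrow> complex"
  assumes "(f has_integral I) {0..1}"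
  shows "((\<lambda>u. f (1 - u)) has_integral I) {0..1}"
proof -
  have "((\<lambda>u. f (- 1 *\<^sub>R u + 1)) has_integral I) ((\<lambda>u. 1 - u) ` {0..1})"
    using has_integral_affinity[of f I 0 1 "-1" 1] assms by simp
  then show ?thesis
    by (simp add: image_diff_atLeastAtMost)
qed

section \<open>The integral representations\<close>

theorem theorem3p2:
  fixes \<alpha> \<beta> b c z :: complex and p :: real
  assumes "Re \<alpha> > -1"
    and "Re c > Re b" and "Re b > 0"
    and "p \<ge> 0"
    and beta_conv: "p > 0 \<Longrightarrow> psi_beta_integrand \<alpha> \<beta> (of_real p) b (c - b) integrable_on {0..1}"
  shows "summable (psi_confluent_term \<alpha> \<beta> (of_real p) b c z)
    \<and> ((\<lambda>t::real. of_real t powr (b - 1) * of_real (1 - t) powr (c - b - 1) * exp (z * of_real t)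
            * wright_psi \<alpha> \<beta> (- of_real p / of_real (t * (1 - t)))) integrable_on {0..1})
    \<and> psi_confluent \<alpha> \<beta> (of_real p) b c z =
      1 / Beta b (c - b) *
        integral {0..1} (\<lambda>t::real. of_real t powr (b - 1) * of_real (1 - t) powr (c - b - 1)
          * exp (z * of_real t) * wright_psi \<alpha> \<beta> (- of_real p / of_real (t * (1 - t))))
    \<and> ((\<lambda>u::real. of_real u powr (c - b - 1) * of_real (1 - u) powr (b - 1)
            * exp (z * of_real (1 - u))
            * wright_psi \<alpha> \<beta> (- of_real p / of_real (u * (1 - u)))) integrable_on {0..1})
    \<and> psi_confluent \<alpha> \<beta> (of_real p) b c z =
      1 / Beta b (c - b) *
        integral {0..1} (\<lambda>u::real. of_real u powr (c - b - 1) * of_real (1 - u) powr (b - 1)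
          * exp (z * of_real (1 - u)) * wright_psi \<alpha> \<beta> (- of_real p / of_real (u * (1 - u))))"
proof -
  define f where "f = psi_beta_integrand \<alpha> \<beta> (of_real p) b (c - b)"
  define J where "J = integral {0..1} (\<lambda>t. exp (z * of_real t) * f t)"
  have f: "f integrable_on {0..1}"
  proof (cases "p = 0")
    case True
    have "(\<lambda>t::real. of_real t powr (b - 1) * of_real (1 - t) powr (c - b - 1) * wright_psi \<alpha> \<beta> 0)
        integrable_on {0..1}"
      using assms by (intro integrable_on_mult_left integrable_on_Beta_complex) auto
    then show ?thesis
      by (simp add: f_def psi_beta_integrand_def [abs_def] True)
  next
    case False
    then show ?thesis
      using assms by (simp add: f_def)
  qed
  have expf: "(\<lambda>t. exp (z * of_real t) * f t) integrable_on {0..1}"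
    and sums: "(\<lambda>n. z ^ n / fact n * integral {0..1} (\<lambda>t. of_real t ^ n * f t)) sums J"
    using integral_power_series_sums[OF f summable_exp_coeff_weighted, of z]
    unfolding exp_mult_power_series J_def .
  have coeff: "psi_beta \<alpha> \<beta> (of_real p) (b + of_nat n) (c - b)
      = integral {0..1} (\<lambda>t. of_real t ^ n * f t)" for n
    unfolding psi_beta_def f_def
    by (rule integral_cong) (simp add: psi_beta_integrand_add_nat)
  have term_sums: "psi_confluent_term \<alpha> \<beta> (of_real p) b c z sums (1 / Beta b (c - b) * J)"
    using sums_mult[OF sums, of "1 / Beta b (c - b)"]
    by (simp add: psi_confluent_term_def [abs_def] coeff mult_ac)
  have I1: "((\<lambda>t::real. of_real t powr (b - 1) * of_real (1 - t) powr (c - b - 1) * exp (z * of_real t)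
      * wright_psi \<alpha> \<beta> (- of_real p / of_real (t * (1 - t)))) has_integral J) {0..1}"
    using integrable_integral[OF expf]
    by (simp add: J_def f_def psi_beta_integrand_def mult_ac)
  have I2: "((\<lambda>u::real. of_real u powr (c - b - 1) * of_real (1 - u) powr (b - 1)
      * exp (z * of_real (1 - u))
      * wright_psi \<alpha> \<beta> (- of_real p / of_real (u * (1 - u)))) has_integral J) {0..1}"
    using has_integral_reflect_unit_interval[OF I1] by (simp add: mult_ac)
  show ?thesis
    using term_sums I1 I2
    by (auto simp: sums_iff psi_confluent_def has_integral_iff)
qed

end
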